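(* Let $B$ and $C$ be (nonconstant) indestructible Blaschke products on the unit disk $\mathbb{D}$. Then the composition $B\circ C$ is an indestructible Blaschke product.
   Context: $\mathbb{D}=\{z\in\mathbb{C}: |z|<1\}$. $\mathrm{Aut}(\mathbb{D})=\left\{z\mapsto \eta\,\frac{z-a}{1-\overline{a}z} : |a|<1,\ |\eta|=1\right\}$ is the group of conformal automorphisms of $\mathbb{D}$. A Blaschke product is a nonconstant function on $\mathbb{D}$ of the form $$B(z)=\eta\prod_{j}\frac{-\overline{a_j}}{|a_j|}\,\frac{z-a_j}{1-\overline{a_j}z},\qquad |\eta|=1,$$ where $(a_j)$ is a nonempty finite or infinite sequence in $\mathbb{D}$ (repetitions allowed) with $\sum_j(1-|a_j|)<\infty$, and the convention $\frac{a}{|a|}=1$ (and likewise $\frac{\overline{a}}{|a|}=1$) is used if $a=0$. Thus finite Blaschke products are included. A nonconstant Blaschke product maps $\mathbb{D}$ into $\mathbb{D}$, so compositions are well defined on $\mathbb{D}$. A Blaschke product $B$ is called indestructible if $T\circ B$ is a Blaschke product for every $T\in\mathrm{Aut}(\mathbb{D})$. *)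

theory Defs
  imports "HOL-Analysis.Analysis"
begin

abbreviation unit_disk :: "complex set" where
  "unit_disk \<equiv> ball 0 1"

(* Functions on the disk are total functions of type complex \<Rightarrow> complex; every notion below
   depends only on their values on unit_disk. *)

definition Aut_disk :: "(complex \<Rightarrow> complex) set" where
  "Aut_disk = {T. \<exists>a \<eta>. norm a < 1 \<and> norm \<eta> = 1 \<and>
     (\<forall>z\<in>unit_disk. T z = \<eta> * ((z - a) / (1 - cnj a * z)))}"

(* At a = 0 the convention is cnj a / |a| = 1, so the factor is -z. *)
definition blaschke_factor :: "complex \<Rightarrow> complex \<Rightarrow> complex" where
  "blaschke_factor a z =
     - (if a = 0 then 1 else cnj a / of_real (norm a)) * ((z - a) / (1 - cnj a * z))"

definition finite_blaschke_form :: "(complex \<Rightarrow> complex) \<Rightarrow> bool" where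
  "finite_blaschke_form B \<longleftrightarrow>
     (\<exists>\<eta> (n::nat) a. norm \<eta> = 1 \<and> n \<ge> 1 \<and> (\<forall>j<n. a j \<in> unit_disk) \<and>
        (\<forall>z\<in>unit_disk. B z = \<eta> * (\<Prod>j<n. blaschke_factor (a j) z)))"

(* The library's has_prod allows the value 0 when only finitely many factors vanish, which
   is the case here: by summability no point occurs infinitely often in the sequence. *)
definition infinite_blaschke_form :: "(complex \<Rightarrow> complex) \<Rightarrow> bool" where
  "infinite_blaschke_form B \<longleftrightarrow>
     (\<exists>\<eta> (a :: nat \<Rightarrow> complex). norm \<eta> = 1 \<and> (\<forall>j. a j \<in> unit_disk) \<and>
        summable (\<lambda>j. 1 - norm (a j)) \<and>
        (\<forall>z\<in>unit_disk. \<exists>p. (\<lambda>j. blaschke_factor (a j) z) has_prod p \<and> B z = \<eta> * p))"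

definition blaschke_product :: "(complex \<Rightarrow> complex) \<Rightarrow> bool" where
  "blaschke_product B \<longleftrightarrow>
     \<not> B constant_on unit_disk \<and> (finite_blaschke_form B \<or> infinite_blaschke_form B)"

definition indestructible_blaschke :: "(complex \<Rightarrow> complex) \<Rightarrow> bool" where
  "indestructible_blaschke B \<longleftrightarrow>
     blaschke_product B \<and> (\<forall>T\<in>Aut_disk. blaschke_product (T \<circ> B))"

end

(* The class of functions eta * prod_i b_(a_i), with b_a the Blaschke factor and a_i any countable
   Blaschke family, is closed under substituting an indestructible C: every b_(a_j) o C is
   eta_j * prod_k b_(c_jk), and summing -ln |b_(c_jk)(z0)| over (j,k) gives -ln |prod_j b_(a_j)(C z0)|,
   finite at all but countably many z0, so that the double family (c_jk) satisfies the Blaschke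
   condition. Since T o (B o C) = (T o B) o C, this suffices. *)
theory Submission
  imports Defs
begin

section \<open>Identities and estimates for a single Blaschke factor\<close>

lemma blaschke_denom_nonzero:
  assumes "a \<in> unit_disk" "z \<in> unit_disk"
  shows "1 - cnj a * z \<noteq> 0"
proof
  assume "1 - cnj a * z = 0"
  then have "norm (cnj a * z) = 1" by simp
  moreover have "norm a * norm z < 1"
    using assms by (simp add: mult_strict_mono[of "norm a" 1 "norm z" 1, simplified])
  ultimately show False by (simp add: norm_mult)
qed

text \<open>Packages the convention at 0: \<open>u\<close> is the normalizing unimodular constant,
  and the two identities relating it to \<open>a\<close> hold for \<open>a = 0\<close> as well, so
  later computations need no case split.\<close>

lemma blaschke_sign:
  fixes a :: complex
  obtains u where "norm u = 1" "u * a = of_real (norm a)" "cnj a = u * of_real (norm a)"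
    "\<And>z. blaschke_factor a z = - u * ((z - a) / (1 - cnj a * z))"
proof (cases "a = 0")
  case True
  with that[of 1] show ?thesis by (simp add: blaschke_factor_def)
next
  case False
  let ?u = "cnj a / of_real (norm a)"
  have "?u * a = of_real (norm a)"
    using False complex_norm_square[of a] by (simp add: field_simps power2_eq_square)
  with False that[of ?u] show ?thesis
    by (simp add: blaschke_factor_def norm_divide)
qed

lemma blaschke_factor_eq_0_iff:
  assumes "a \<in> unit_disk" "z \<in> unit_disk"
  shows "blaschke_factor a z = 0 \<longleftrightarrow> z = a"
  using blaschke_denom_nonzero[OF assms] by (simp add: blaschke_factor_def)

text \<open>Rests on the identity 1 - b_a(z) = (1 - |a|)(1 + uz) / (1 - cnj a * z), where the second
  factor is at most 2 in norm and the denominator at least 1 - |z|. This turns the Blaschke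
  condition into absolute convergence at every point of the disk.\<close>

lemma norm_one_minus_blaschke_factor:
  assumes a: "a \<in> unit_disk" and z: "z \<in> unit_disk"
  shows "norm (1 - blaschke_factor a z) \<le> 2 / (1 - norm z) * (1 - norm a)"
proof -
  obtain u where u: "norm u = 1" "u * a = of_real (norm a)" "cnj a = u * of_real (norm a)"
    "blaschke_factor a z = - u * ((z - a) / (1 - cnj a * z))"
    using blaschke_sign[of a] by metis
  define d where "d = 1 - cnj a * z"
  have d0: "d \<noteq> 0" unfolding d_def by (rule blaschke_denom_nonzero[OF a z])
  have "1 - blaschke_factor a z = (d + u * z - u * a) / d"
    using d0 unfolding u(4) d_def[symmetric] by (simp add: field_simps)
  also have "d + u * z - u * a = (1 - of_real (norm a)) * (1 + u * z)"
    using u(2,3) by (simp add: d_def algebra_simps)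
  finally have "1 - blaschke_factor a z = (1 - of_real (norm a)) * (1 + u * z) / d" .
  moreover have na: "norm (1 - complex_of_real (norm a)) = 1 - norm a"
    using a norm_of_real[of "1 - norm a", where ?'a = complex] by simp
  ultimately have "norm (1 - blaschke_factor a z) = (1 - norm a) * norm (1 + u * z) / norm d"
    using na by (simp add: norm_mult norm_divide)
  also have "\<dots> \<le> (1 - norm a) * 2 / (1 - norm z)"
  proof (rule frac_le)
    have "norm (1 + u * z) \<le> 1 + norm (u * z)" by (metis norm_one norm_triangle_ineq)
    also have "\<dots> \<le> 2" using u z by (simp add: norm_mult)
    finally show "(1 - norm a) * norm (1 + u * z) \<le> (1 - norm a) * 2"
      using a by (intro mult_left_mono) auto
    have "1 - norm (cnj a * z) \<le> norm d"
      unfolding d_def by (metis norm_one norm_triangle_ineq2)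
    moreover have "norm (cnj a * z) \<le> norm z"
      using a by (simp add: norm_mult mult_left_le_one_le)
    ultimately show "1 - norm z \<le> norm d" by linarith
  qed (use a z in auto)
  finally show ?thesis by (simp add: mult.commute)
qed

text \<open>The pseudohyperbolic identity: |1 - cnj a * z|^2 - |z - a|^2 factors as (1 - |a|^2)(1 -
  |z|^2).\<close>

lemma one_minus_norm_blaschke_factor_sq:
  assumes a: "a \<in> unit_disk" and z: "z \<in> unit_disk"
  shows "1 - norm (blaschke_factor a z) ^ 2
    = (1 - norm a ^ 2) * (1 - norm z ^ 2) / norm (1 - cnj a * z) ^ 2"
proof -
  obtain u where u: "norm u = 1"
    "blaschke_factor a z = - u * ((z - a) / (1 - cnj a * z))"
    using blaschke_sign[of a] by metis
  have d0: "1 - cnj a * z \<noteq> 0" by (rule blaschke_denom_nonzero[OF a z])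
  have *: "norm (1 - cnj a * z) ^ 2 - norm (z - a) ^ 2 = (1 - norm a ^ 2) * (1 - norm z ^ 2)"
    unfolding cmod_power2 by (simp add: algebra_simps power2_eq_square)
  have "norm (blaschke_factor a z) = norm (z - a) / norm (1 - cnj a * z)"
    using u by (simp add: norm_mult norm_divide)
  then have "1 - norm (blaschke_factor a z) ^ 2
      = (norm (1 - cnj a * z) ^ 2 - norm (z - a) ^ 2) / norm (1 - cnj a * z) ^ 2"
    using d0 by (simp add: power_divide diff_divide_distrib)
  then show ?thesis unfolding * .
qed

lemma norm_blaschke_factor_less_1:
  assumes "a \<in> unit_disk" "z \<in> unit_disk"
  shows "norm (blaschke_factor a z) < 1"
proof -
  have "0 < 1 - norm (blaschke_factor a z) ^ 2"
    unfolding one_minus_norm_blaschke_factor_sq[OF assms]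
    using assms blaschke_denom_nonzero[OF assms] by (simp add: power_less_one_iff)
  then show ?thesis by (simp add: power_less_one_iff)
qed

text \<open>Serves as the converse estimate: convergence of the logarithms at a single point off the
  zeros forces the Blaschke condition. It combines the pseudohyperbolic identity with 1 - x \<le>
  -ln x at x = |b|^2. The 8 is 4 * 2, with 4 bounding |1 - cnj a * z|^2 and 2 coming from ln(|b|^2)
  = 2 ln |b|.\<close>

lemma one_minus_norm_le_log:
  assumes a: "a \<in> unit_disk" and z: "z \<in> unit_disk" and "z \<noteq> a"
  shows "1 - norm a \<le> 8 / (1 - norm z ^ 2) * - ln (norm (blaschke_factor a z))"
proof -
  let ?b = "norm (blaschke_factor a z)" and ?d = "norm (1 - cnj a * z)"
  have b: "?b > 0" using blaschke_factor_eq_0_iff[OF a z] assms(3) by simp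
  have d: "0 < ?d" using blaschke_denom_nonzero[OF a z] by simp
  have "?d \<le> 1 + norm (cnj a * z)" by (metis norm_one norm_triangle_ineq4)
  also have "\<dots> \<le> 2" using a z mult_le_one[of "norm a" "norm z"] by (simp add: norm_mult)
  finally have d2: "?d ^ 2 \<le> 4" using d power_mono[of ?d 2 2] by simp
  have z1: "1 - norm z ^ 2 > 0" using z by (simp add: power_less_one_iff)
  have na: "norm a ^ 2 \<le> norm a"
    using a by (simp add: power2_eq_square mult_left_le_one_le)
  have "(1 - norm a) * (1 - norm z ^ 2) \<le> (1 - norm a ^ 2) * (1 - norm z ^ 2)"
    using na z1 by (intro mult_right_mono) auto
  also have "\<dots> = (1 - ?b ^ 2) * ?d ^ 2"
    using one_minus_norm_blaschke_factor_sq[OF a z] d by simp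
  also have "\<dots> \<le> (1 - ?b ^ 2) * 4"
    using d2 norm_blaschke_factor_less_1[OF a z]
    by (intro mult_left_mono) (auto simp: power_le_one)
  also have "1 - ?b ^ 2 \<le> - ln (?b ^ 2)"
    using ln_le_minus_one[of "?b ^ 2"] b by simp
  also have "ln (?b ^ 2) = 2 * ln ?b" using b by (simp add: ln_realpow)
  finally have "(1 - norm a) * (1 - norm z ^ 2) \<le> 8 * - ln ?b" by simp
  then show ?thesis using z1 by (simp add: field_simps)
qed

lemma blaschke_factor_Aut_disk:
  assumes "a \<in> unit_disk"
  shows "blaschke_factor a \<in> Aut_disk"
proof -
  obtain u where u: "norm u = 1"
    "\<And>z. blaschke_factor a z = - u * ((z - a) / (1 - cnj a * z))"
    using blaschke_sign[of a] by metis
  then show ?thesis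
    unfolding Aut_disk_def using assms by (intro CollectI exI[of _ a] exI[of _ "- u"]) auto
qed

section \<open>Unordered sums of logarithms and the products over countable families built from
  them\<close>

lemma finite_ge_if_summable_on:
  fixes f :: "'i \<Rightarrow> real"
  assumes "f summable_on I" "\<And>i. i \<in> I \<Longrightarrow> f i \<ge> 0" "e > 0"
  shows "finite {i\<in>I. f i \<ge> e}"
proof (rule ccontr)
  assume inf: "infinite {i\<in>I. f i \<ge> e}"
  obtain n :: nat where n: "infsum f I / e < of_nat n" using reals_Archimedean2 by blast
  obtain F where F: "finite F" "card F = n" "F \<subseteq> {i\<in>I. f i \<ge> e}"
    using infinite_arbitrarily_large[OF inf] by blast
  have "of_nat n * e = (\<Sum>i\<in>F. e)" using F by simp
  also have "\<dots> \<le> sum f F" using F by (intro sum_mono) auto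
  also have "\<dots> \<le> infsum f I"
    using F assms by (intro finite_sum_le_infsum) auto
  finally show False using n assms(3) by (simp add: field_simps)
qed

text \<open>All but finitely many \<open>x i\<close> lie within 1/2 of 1, where |Ln x| \<le> 2|x -
  1|. The finite remainder cannot spoil summability, so even \<open>x i = 0\<close> is
  harmless.\<close>

lemma Ln_abs_summable_on:
  assumes "(\<lambda>i. norm (1 - x i)) summable_on I"
  shows "(\<lambda>i. norm (Ln (x i))) summable_on I"
proof -
  let ?F = "{i\<in>I. norm (1 - x i) \<ge> 1/2}"
  have fin: "finite ?F" by (rule finite_ge_if_summable_on[OF assms]) auto
  have "(\<lambda>i. norm (Ln (x i))) summable_on (I - ?F)"
  proof (rule summable_on_comparison_test)
    show "(\<lambda>i. 2 * norm (1 - x i)) summable_on (I - ?F)"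
      by (intro summable_on_cmult_right summable_on_subset_banach[OF assms]) auto
    fix i assume "i \<in> I - ?F"
    then have "norm (x i - 1) < 1/2" by (auto simp: norm_minus_commute)
    then show "norm (Ln (x i)) \<le> 2 * norm (1 - x i)"
      using norm_Ln_le[of "x i - 1"] by (simp add: norm_minus_commute)
  qed auto
  then have "(\<lambda>i. norm (Ln (x i))) summable_on ((I - ?F) \<union> ?F)"
    using fin by (intro summable_on_Un_disjoint) auto
  moreover have "(I - ?F) \<union> ?F = I" by auto
  ultimately show ?thesis by simp
qed

text \<open>Handles different branches of the logarithm: the terms may differ by multiples of 2
  \<pi> i, but exponentials of finite partial sums are products that agree, and so their limits
  agree.\<close>

lemma exp_has_sum_cong:
  fixes f g :: "'i \<Rightarrow> complex"
  assumes f: "(f has_sum s) I" and g: "(g has_sum t) I"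
    and eq: "\<And>i. i \<in> I \<Longrightarrow> exp (f i) = exp (g i)"
  shows "exp s = exp t"
proof -
  have s: "((\<lambda>X. exp (sum f X)) \<longlongrightarrow> exp s) (finite_subsets_at_top I)"
    using f unfolding has_sum_def by (rule tendsto_exp)
  have t: "((\<lambda>X. exp (sum g X)) \<longlongrightarrow> exp t) (finite_subsets_at_top I)"
    using g unfolding has_sum_def by (rule tendsto_exp)
  have "eventually (\<lambda>X. exp (sum f X) = exp (sum g X)) (finite_subsets_at_top I)"
    using eq by (intro eventually_finite_subsets_at_top_weakI)
      (auto simp: exp_sum intro!: prod.cong)
  with s have "((\<lambda>X. exp (sum g X)) \<longlongrightarrow> exp s) (finite_subsets_at_top I)"
    using tendsto_cong by fast
  then show ?thesis by (rule tendsto_unique[OF finite_subsets_at_top_neq_bot _ t])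
qed

text \<open>An arbitrary index type lets the double family indexed by pairs be treated directly, and
  finite and infinite products together.\<close>

definition blaschke_family :: "'i set \<Rightarrow> ('i \<Rightarrow> complex) \<Rightarrow> bool" where
  "blaschke_family I a \<longleftrightarrow> I \<noteq> {} \<and> countable I \<and> a ` I \<subseteq> unit_disk
     \<and> (\<lambda>i. 1 - norm (a i)) summable_on I"

(* Writing the product as exp of a sum of logarithms reduces reindexing and iterated products to
   unordered sums; the case split is needed since Ln 0 is a junk value. *)
definition blaschke_prod_on :: "'i set \<Rightarrow> ('i \<Rightarrow> complex) \<Rightarrow> complex \<Rightarrow> complex" where
  "blaschke_prod_on I a z =
     (if z \<in> a ` I then 0 else exp (\<Sum>\<^sub>\<infinity>i\<in>I. Ln (blaschke_factor (a i) z)))"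

lemma blaschke_family_abs_summable:
  assumes "blaschke_family I a" "z \<in> unit_disk"
  shows "(\<lambda>i. norm (1 - blaschke_factor (a i) z)) summable_on I"
proof (rule summable_on_comparison_test)
  show "(\<lambda>i. 2 / (1 - norm z) * (1 - norm (a i))) summable_on I"
    using assms by (intro summable_on_cmult_right) (auto simp: blaschke_family_def)
  show "norm (1 - blaschke_factor (a i) z) \<le> 2 / (1 - norm z) * (1 - norm (a i))" if "i \<in> I" for i
    using assms that by (intro norm_one_minus_blaschke_factor) (auto simp: blaschke_family_def)
qed auto

lemma blaschke_family_Ln:
  assumes "blaschke_family I a" "z \<in> unit_disk"
  shows "(\<lambda>i. norm (Ln (blaschke_factor (a i) z))) summable_on I"
    and "((\<lambda>i. Ln (blaschke_factor (a i) z)) has_sum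
           (\<Sum>\<^sub>\<infinity>i\<in>I. Ln (blaschke_factor (a i) z))) I"
  using Ln_abs_summable_on[OF blaschke_family_abs_summable[OF assms]]
  by (auto intro: has_sum_infsum abs_summable_summable)

lemma blaschke_prod_on_eq_0_iff: "blaschke_prod_on I a z = 0 \<longleftrightarrow> z \<in> a ` I"
  by (simp add: blaschke_prod_on_def)

text \<open>Taking real parts of the sum of \<open>Ln\<close> removes the choice of branch. In this
  form the zeros of a composition can be counted by summing real terms of one sign.\<close>

lemma blaschke_prod_on_log_norm:
  assumes fam: "blaschke_family I a" and z: "z \<in> unit_disk" and nz: "z \<notin> a ` I"
  shows "((\<lambda>i. ln (norm (blaschke_factor (a i) z))) has_sum
           ln (norm (blaschke_prod_on I a z))) I"
proof -
  have "((\<lambda>i. Re (Ln (blaschke_factor (a i) z))) has_sum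
          ln (norm (blaschke_prod_on I a z))) I"
    using has_sum_Re[OF blaschke_family_Ln(2)[OF fam z]] nz by (simp add: blaschke_prod_on_def)
  moreover have "Re (Ln (blaschke_factor (a i) z)) = ln (norm (blaschke_factor (a i) z))"
    if "i \<in> I" for i
  proof -
    have "a i \<in> unit_disk" using fam that by (auto simp: blaschke_family_def)
    then show ?thesis
      using blaschke_factor_eq_0_iff[OF _ z, of "a i"] that nz by (intro Re_Ln) auto
  qed
  ultimately show ?thesis by (simp cong: has_sum_cong)
qed

text \<open>Off the zeros every term of the logarithmic sum is negative and the index set is
  nonempty, so the sum is strictly negative.\<close>

lemma norm_blaschke_prod_on_less_1:
  assumes fam: "blaschke_family I a" and z: "z \<in> unit_disk"
  shows "norm (blaschke_prod_on I a z) < 1"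
proof (cases "z \<in> a ` I")
  case True
  then show ?thesis by (simp add: blaschke_prod_on_def)
next
  case False
  have neg: "ln (norm (blaschke_factor (a i) z)) < 0" if "i \<in> I" for i
  proof -
    have "a i \<in> unit_disk" using fam that by (auto simp: blaschke_family_def)
    then show ?thesis
      using blaschke_factor_eq_0_iff[OF _ z, of "a i"] norm_blaschke_factor_less_1[OF _ z, of "a i"]
        that False by auto
  qed
  obtain i where i: "i \<in> I" using fam by (auto simp: blaschke_family_def)
  have "ln (norm (blaschke_prod_on I a z)) < 0"
    using neg i
    by (intro has_sum_strict_mono[OF blaschke_prod_on_log_norm[OF fam z False] has_sum_0, of "\<lambda>_. 0" i])
      (auto intro: less_imp_le)
  moreover have "norm (blaschke_prod_on I a z) > 0"
    using False by (simp add: blaschke_prod_on_def)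
  ultimately show ?thesis by (simp add: ln_less_zero_iff)
qed

lemma blaschke_reindex:
  assumes h: "bij_betw h J I" and fam: "blaschke_family I a"
  shows "blaschke_family J (a \<circ> h)" "blaschke_prod_on J (a \<circ> h) = blaschke_prod_on I a"
proof -
  have img: "h ` J = I" using h by (simp add: bij_betw_def)
  have "countable J" using fam h
    by (metis blaschke_family_def bij_betw_def countable_image_inj_on)
  then show "blaschke_family J (a \<circ> h)"
    using fam img summable_on_reindex_bij_betw[OF h, of "\<lambda>i. 1 - norm (a i)"]
    by (auto simp: blaschke_family_def)
  show "blaschke_prod_on J (a \<circ> h) = blaschke_prod_on I a"
  proof
    fix z
    show "blaschke_prod_on J (a \<circ> h) z = blaschke_prod_on I a z"
      using infsum_reindex_bij_betw[OF h, of "\<lambda>i. Ln (blaschke_factor (a i) z)"] img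
      by (auto simp: blaschke_prod_on_def)
  qed
qed

section \<open>Passage between products over families and the finite and infinite forms\<close>

lemma blaschke_prod_on_finite:
  assumes "finite I" "a ` I \<subseteq> unit_disk" "z \<in> unit_disk"
  shows "blaschke_prod_on I a z = (\<Prod>i\<in>I. blaschke_factor (a i) z)"
proof -
  have *: "blaschke_factor (a i) z = 0 \<longleftrightarrow> z = a i" if "i \<in> I" for i
    using assms that by (intro blaschke_factor_eq_0_iff) auto
  show ?thesis
  proof (cases "z \<in> a ` I")
    case True
    then show ?thesis using * assms(1) by (auto simp: blaschke_prod_on_def)
  next
    case False
    then have "exp (Ln (blaschke_factor (a i) z)) = blaschke_factor (a i) z" if "i \<in> I" for i
      using *[OF that] that by (intro exp_Ln) auto
    then show ?thesis
      using False assms(1) by (simp add: blaschke_prod_on_def exp_sum)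
  qed
qed

lemma blaschke_prod_on_has_prod:
  assumes fam: "blaschke_family (UNIV :: nat set) a" and z: "z \<in> unit_disk"
  shows "(\<lambda>i. blaschke_factor (a i) z) has_prod blaschke_prod_on UNIV a z"
proof -
  have *: "blaschke_factor (a i) z = 0 \<longleftrightarrow> z = a i" for i
    using fam z by (intro blaschke_factor_eq_0_iff) (unfold blaschke_family_def, blast+)
  show ?thesis
  proof (cases "z \<in> range a")
    case True
    \<comment> \<open>At a zero the logarithms say nothing, so convergence comes from absolute
      summability of the factors minus 1, and the vanishing factor then makes the value 0.\<close>
    then obtain i where i: "z = a i" by auto
    have "summable (\<lambda>i. norm (blaschke_factor (a i) z - 1))"
      using summable_on_imp_summable[OF blaschke_family_abs_summable[OF fam z]]
      by (simp add: norm_minus_commute)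
    then have "convergent_prod (\<lambda>i. blaschke_factor (a i) z)"
      by (intro abs_convergent_prod_imp_convergent_prod)
        (simp add: abs_convergent_prod_conv_summable)
    then have p: "(\<lambda>i. blaschke_factor (a i) z) has_prod (\<Prod>i. blaschke_factor (a i) z)"
      by (rule convergent_prod_has_prod)
    have "(\<Prod>i. blaschke_factor (a i) z) = 0"
      using p * [of i] i by (intro has_prod_zeroI[OF p, of i]) simp
    with p True show ?thesis by (simp add: blaschke_prod_on_def)
  next
    case False
    have e: "exp (Ln (blaschke_factor (a i) z)) = blaschke_factor (a i) z" for i
      using *[of i] False by (intro exp_Ln) auto
    have "(\<lambda>i. Ln (blaschke_factor (a i) z)) sums (\<Sum>\<^sub>\<infinity>i. Ln (blaschke_factor (a i) z))"
      by (rule has_sum_imp_sums[OF blaschke_family_Ln(2)[OF fam z]])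
    from sums_imp_has_prod_exp[OF this] show ?thesis
      using False by (simp add: has_prod_def e blaschke_prod_on_def)
  qed
qed

text \<open>The index set is an initial segment for the finite form and \<open>UNIV\<close> for the
  infinite one; uniqueness of the limit identifies the value of the infinite product.\<close>

lemma blaschke_productD:
  assumes "blaschke_product B"
  obtains \<eta> and I :: "nat set" and a where "norm \<eta> = 1" "blaschke_family I a"
    "\<And>z. z \<in> unit_disk \<Longrightarrow> B z = \<eta> * blaschke_prod_on I a z"
  using assms unfolding blaschke_product_def
proof (elim conjE disjE)
  assume "finite_blaschke_form B"
  then obtain \<eta> and n :: nat and a where *: "norm \<eta> = 1" "n \<ge> 1" "\<forall>j<n. a j \<in> unit_disk"
    "\<forall>z\<in>unit_disk. B z = \<eta> * (\<Prod>j<n. blaschke_factor (a j) z)"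
    unfolding finite_blaschke_form_def by blast
  have "blaschke_family {..<n} a" using * by (auto simp: blaschke_family_def lessThan_empty_iff)
  then show thesis
    using * by (intro that[of \<eta> "{..<n}" a]) (auto simp: blaschke_prod_on_finite image_subset_iff)
next
  assume "infinite_blaschke_form B"
  then obtain \<eta> and a :: "nat \<Rightarrow> complex" where *: "norm \<eta> = 1" "\<forall>j. a j \<in> unit_disk"
    "summable (\<lambda>j. 1 - norm (a j))"
    "\<forall>z\<in>unit_disk. \<exists>p. (\<lambda>j. blaschke_factor (a j) z) has_prod p \<and> B z = \<eta> * p"
    unfolding infinite_blaschke_form_def by blast
  have "(\<lambda>j. 1 - norm (a j)) summable_on UNIV"
    using * by (subst summable_on_UNIV_nonneg_real_iff) (auto intro: less_imp_le)
  then have fam: "blaschke_family UNIV a" using * by (auto simp: blaschke_family_def)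
  show thesis
    using * has_prod_unique2[OF blaschke_prod_on_has_prod[OF fam]]
    by (intro that[OF _ fam, of \<eta>]) blast+
qed

(* A Blaschke product vanishes somewhere, but only at countably many points. *)
lemma blaschke_prod_not_constant_on:
  assumes fam: "blaschke_family I a" and "\<eta> \<noteq> 0"
    and B: "\<And>z. z \<in> unit_disk \<Longrightarrow> B z = \<eta> * blaschke_prod_on I a z"
  shows "\<not> B constant_on unit_disk"
proof
  assume const: "B constant_on unit_disk"
  obtain i where i: "i \<in> I" using fam by (auto simp: blaschke_family_def)
  then have ai: "a i \<in> unit_disk" "B (a i) = 0"
    using fam B[of "a i"] by (auto simp: blaschke_family_def blaschke_prod_on_eq_0_iff)
  have "unit_disk - a ` I \<noteq> {}"
    using fam by (intro ball_minus_countable_nonempty) (auto simp: blaschke_family_def)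
  then obtain w where w: "w \<in> unit_disk" "w \<notin> a ` I" by blast
  then have "B w \<noteq> 0" using B[of w] assms(2) by (auto simp: blaschke_prod_on_eq_0_iff)
  then show False using const ai w by (metis constant_on_def)
qed

text \<open>Enumerating \<open>I\<close> by \<open>from_nat_into\<close> carries the family to an
  initial segment or to all naturals, according to whether \<open>I\<close> is finite.\<close>

lemma blaschke_productI:
  assumes \<eta>: "norm \<eta> = 1" and fam: "blaschke_family I a"
    and B: "\<And>z. z \<in> unit_disk \<Longrightarrow> B z = \<eta> * blaschke_prod_on I a z"
  shows "blaschke_product B"
proof -
  have "\<not> B constant_on unit_disk"
    using \<eta> by (intro blaschke_prod_not_constant_on[OF fam _ B]) auto
  moreover have "finite_blaschke_form B \<or> infinite_blaschke_form B"
  proof (cases "finite I")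
    case True
    note h = bij_betw_from_nat_into_finite[OF True]
    let ?c = "a \<circ> from_nat_into I"
    have c: "?c ` {..<card I} \<subseteq> unit_disk"
      using blaschke_reindex(1)[OF h fam] by (simp add: blaschke_family_def)
    have "\<forall>z\<in>unit_disk. B z = \<eta> * (\<Prod>j<card I. blaschke_factor (?c j) z)"
      using B blaschke_prod_on_finite[OF _ c] by (simp add: blaschke_reindex(2)[OF h fam])
    moreover have "card I \<ge> 1"
      using True fam by (simp add: blaschke_family_def Suc_le_eq card_gt_0_iff)
    ultimately show ?thesis
      using \<eta> c unfolding finite_blaschke_form_def
      by (intro disjI1 exI[of _ \<eta>] exI[of _ "card I"] exI[of _ ?c]) (auto simp: image_subset_iff)
  next
    case False
    have "countable I" using fam by (simp add: blaschke_family_def)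
    note h = bij_betw_from_nat_into[OF this False]
    let ?c = "a \<circ> from_nat_into I"
    note c = blaschke_reindex(1)[OF h fam]
    have "\<forall>z\<in>unit_disk. \<exists>p. (\<lambda>j. blaschke_factor (?c j) z) has_prod p \<and> B z = \<eta> * p"
      using B blaschke_prod_on_has_prod[OF c] by (metis blaschke_reindex(2)[OF h fam])
    moreover have "summable (\<lambda>j. 1 - norm (?c j))" "\<forall>j. ?c j \<in> unit_disk"
      using c summable_on_imp_summable[of "\<lambda>j. 1 - norm (?c j)"]
      unfolding blaschke_family_def by blast+
    ultimately show ?thesis
      using \<eta> unfolding infinite_blaschke_form_def
      by (intro disjI2 exI[of _ \<eta>] exI[of _ ?c]) auto
  qed
  ultimately show ?thesis by (simp add: blaschke_product_def)
qed

lemma blaschke_product_in_unit_disk: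
  assumes "blaschke_product B" "z \<in> unit_disk"
  shows "B z \<in> unit_disk"
proof -
  obtain \<eta> and I :: "nat set" and a where "norm \<eta> = 1" "blaschke_family I a"
    "B z = \<eta> * blaschke_prod_on I a z"
    using blaschke_productD[OF assms(1)] assms(2) by metis
  then show ?thesis
    using norm_blaschke_prod_on_less_1[of I a z] assms(2) by (simp add: norm_mult)
qed

section \<open>Substituting an indestructible Blaschke product\<close>

lemma blaschke_product_compose:
  assumes B: "blaschke_product B" and C: "indestructible_blaschke C"
  shows "blaschke_product (B \<circ> C)"
proof -
  obtain \<eta> and J :: "nat set" and a where \<eta>: "norm \<eta> = 1" and a: "blaschke_family J a"
    and Beq: "\<And>z. z \<in> unit_disk \<Longrightarrow> B z = \<eta> * blaschke_prod_on J a z"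
    using blaschke_productD[OF B] by blast
  have Cd: "C z \<in> unit_disk" if "z \<in> unit_disk" for z
    using blaschke_product_in_unit_disk C that by (auto simp: indestructible_blaschke_def)
  have aj: "a j \<in> unit_disk" if "j \<in> J" for j using a that by (auto simp: blaschke_family_def)
  have "\<forall>j\<in>J. \<exists>e (K :: nat set) c. norm e = 1 \<and> blaschke_family K c \<and>
      (\<forall>z\<in>unit_disk. blaschke_factor (a j) (C z) = e * blaschke_prod_on K c z)"
  proof
    fix j assume "j \<in> J"
    then have "blaschke_product (blaschke_factor (a j) \<circ> C)"
      using C blaschke_factor_Aut_disk[OF aj] by (simp add: indestructible_blaschke_def)
    from blaschke_productD[OF this] show "\<exists>e (K :: nat set) c. norm e = 1 \<and> blaschke_family K c \<and>
      (\<forall>z\<in>unit_disk. blaschke_factor (a j) (C z) = e * blaschke_prod_on K c z)"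
      by (metis comp_apply)
  qed
  from this[unfolded bchoice_iff] obtain e and K :: "nat \<Rightarrow> nat set" and c where
    *: "\<forall>j\<in>J. norm (e j) = 1 \<and> blaschke_family (K j) (c j) \<and>
      (\<forall>z\<in>unit_disk. blaschke_factor (a j) (C z) = e j * blaschke_prod_on (K j) (c j) z)"
    by blast
  then have e: "norm (e j) = 1" and c: "blaschke_family (K j) (c j)" if "j \<in> J" for j
    using that by blast+
  from * have eq: "blaschke_factor (a j) (C z) = e j * blaschke_prod_on (K j) (c j) z"
    if "j \<in> J" "z \<in> unit_disk" for j z
    using that by blast
  let ?I = "Sigma J K" and ?c = "\<lambda>(j, k). c j k"
  have img: "?c ` ?I = (\<Union>j\<in>J. c j ` K j)" by force
  have zero_iff: "C z = a j \<longleftrightarrow> z \<in> c j ` K j" if "j \<in> J" "z \<in> unit_disk" for j z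
  proof -
    have "e j \<noteq> 0" using e[OF that(1)] by auto
    then show ?thesis
      using eq[OF that] blaschke_factor_eq_0_iff[OF aj Cd, OF that]
      by (auto simp: blaschke_prod_on_eq_0_iff)
  qed
  have zero: "C z \<in> a ` J \<longleftrightarrow> z \<in> ?c ` ?I" if "z \<in> unit_disk" for z
    using zero_iff that unfolding img by auto
  have cI: "?c i \<in> unit_disk" if "i \<in> ?I" for i
    using that c by (fastforce simp: blaschke_family_def)
  have count: "countable ?I" using a c by (auto simp: blaschke_family_def)
  \<comment> \<open>One point off all the zeros suffices: there every logarithm is genuine and
    \<open>one_minus_norm_le_log\<close> applies to each index.\<close>
  have "unit_disk - ?c ` ?I \<noteq> {}"
    using count by (intro ball_minus_countable_nonempty) auto
  then obtain z0 where z0: "z0 \<in> unit_disk" "z0 \<notin> ?c ` ?I" by blast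

  have "(\<lambda>i. - ln (norm (blaschke_factor (?c i) z0))) summable_on ?I"
  \<comment> \<open>Tonelli: the terms are nonnegative, and since |\<open>e j\<close>| = 1 row
    \<open>j\<close> sums to the logarithmic term of \<open>a j\<close> at \<open>C z0\<close>;
    these row sums are summable by the Blaschke condition for \<open>a\<close>.\<close>
  proof (rule summable_on_SigmaI)
    fix j assume j: "j \<in> J"
    then have "z0 \<notin> c j ` K j" using z0 unfolding img by auto
    note blaschke_prod_on_log_norm[OF c[OF j] z0(1) this]
    moreover have "norm (blaschke_prod_on (K j) (c j) z0) = norm (blaschke_factor (a j) (C z0))"
      using eq[OF j z0(1)] e[OF j] by (simp add: norm_mult)
    ultimately show "((\<lambda>k. - ln (norm (blaschke_factor (?c (j, k)) z0))) has_sum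
        - ln (norm (blaschke_factor (a j) (C z0)))) (K j)"
      by (simp add: has_sum_uminus)
  next
    have "(\<lambda>j. ln (norm (blaschke_factor (a j) (C z0)))) summable_on J"
      using blaschke_prod_on_log_norm[OF a Cd[OF z0(1)]] zero z0 summable_on_def by blast
    then show "(\<lambda>j. - ln (norm (blaschke_factor (a j) (C z0)))) summable_on J"
      by (simp add: summable_on_uminus)
  next
    fix j k assume "j \<in> J" "k \<in> K j"
    then have "c j k \<in> unit_disk" using cI[of "(j, k)"] by simp
    then have "norm (blaschke_factor (c j k) z0) < 1"
      using norm_blaschke_factor_less_1 z0 by blast
    \<comment> \<open>The case of a vanishing factor is covered by the default value
      \<open>ln 0 = 0\<close>.\<close>
    then show "0 \<le> - ln (norm (blaschke_factor (?c (j, k)) z0))"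
      by (cases "blaschke_factor (c j k) z0 = 0") auto
  qed
  then have "(\<lambda>i. 8 / (1 - norm z0 ^ 2) * - ln (norm (blaschke_factor (?c i) z0))) summable_on ?I"
    by (rule summable_on_cmult_right)
  then have "(\<lambda>i. 1 - norm (?c i)) summable_on ?I"
  proof (rule summable_on_comparison_test)
    fix i assume i: "i \<in> ?I"
    show "1 - norm (?c i) \<le> 8 / (1 - norm z0 ^ 2) * - ln (norm (blaschke_factor (?c i) z0))"
      using z0 i by (intro one_minus_norm_le_log cI) auto
    show "0 \<le> 1 - norm (?c i)" using cI[OF i] by simp
  qed
  moreover have "?I \<noteq> {}"
    using a c by (metis Sigma_empty_iff blaschke_family_def ex_in_conv)
  ultimately have fam: "blaschke_family ?I ?c"
    using cI count by (auto simp: blaschke_family_def)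

  \<comment> \<open>Off the zeros, \<open>L z j\<close> is a logarithm of the \<open>j\<close>-th
    factor of B at \<open>C z\<close>, and \<open>M z j\<close> one of its Blaschke product in z
    without the constant \<open>e j\<close>. Their difference is a logarithm of \<open>e j\<close>,
    on a branch that may depend on z.\<close>
  define M where "M z j = (\<Sum>\<^sub>\<infinity>k\<in>K j. Ln (blaschke_factor (c j k) z))" for z j
  define L where "L z j = Ln (blaschke_factor (a j) (C z))" for z j
  define S where "S z = (\<Sum>\<^sub>\<infinity>i\<in>?I. Ln (blaschke_factor (?c i) z))" for z
  define T where "T z = (\<Sum>\<^sub>\<infinity>j\<in>J. L z j)" for z
  have sum_diff: "((\<lambda>j. L z j - M z j) has_sum (T z - S z)) J" if z: "z \<in> unit_disk" for z
  proof -
    have "(L z has_sum T z) J"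
      unfolding L_def T_def by (rule blaschke_family_Ln(2)[OF a Cd[OF z]])
    moreover have "(M z has_sum S z) J"
      unfolding M_def S_def
    \<comment> \<open>Fubini: the double sum \<open>S z\<close> is evaluated row by row. Convergence
      persists at zeros, where \<open>Ln 0\<close> is junk; the values are interpreted only off
      them.\<close>
    proof (rule has_sum_SigmaD[OF blaschke_family_Ln(2)[OF fam z]])
      show "((\<lambda>k. Ln (blaschke_factor (?c (j, k)) z)) has_sum
          (\<Sum>\<^sub>\<infinity>k\<in>K j. Ln (blaschke_factor (c j k) z))) (K j)" if "j \<in> J" for j
        using blaschke_family_Ln(2)[OF c[OF that] z] by simp
    qed
    ultimately show ?thesis
      using has_sum_add[of "L z" J "T z" "\<lambda>j. - M z j" "- S z"] by (simp add: has_sum_uminus)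
  qed
  have exp_LM: "exp (L z j - M z j) = e j"
    if z: "z \<in> unit_disk" "z \<notin> ?c ` ?I" and j: "j \<in> J" for z j
  proof -
    have "z \<notin> c j ` K j" using z(2) j unfolding img by auto
    then have p: "blaschke_prod_on (K j) (c j) z = exp (M z j)"
      by (simp add: blaschke_prod_on_def M_def)
    have "e j \<noteq> 0" using e[OF j] by auto
    then have "exp (L z j) = e j * exp (M z j)"
      using eq[OF j z(1)] p by (simp add: L_def)
    then show ?thesis by (simp add: exp_diff)
  qed
  (* The unimodular constants e j multiply to a limit that does not depend on z. *)
  define \<theta> where "\<theta> = exp (T z0 - S z0)"
  \<comment> \<open>A logarithm of a unimodular number is purely imaginary, hence so is the sum of
    all of them.\<close>
  have "((\<lambda>j. Re (L z0 j - M z0 j)) has_sum Re (T z0 - S z0)) J"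
    by (rule has_sum_Re[OF sum_diff[OF z0(1)]])
  moreover have "Re (L z0 j - M z0 j) = 0" if "j \<in> J" for j
  proof -
    have "norm (exp (L z0 j - M z0 j)) = 1" using exp_LM[OF z0 that] e[OF that] by simp
    then show ?thesis by simp
  qed
  ultimately have "Re (T z0 - S z0) = 0"
    using has_sum_0[of J "\<lambda>j. Re (L z0 j - M z0 j)"] has_sum_unique by blast
  then have \<theta>: "norm \<theta> = 1" by (simp add: \<theta>_def)
  have "(B \<circ> C) z = \<eta> * \<theta> * blaschke_prod_on ?I ?c z" if z: "z \<in> unit_disk" for z
  proof (cases "z \<in> ?c ` ?I")
    case True
    then show ?thesis using Beq[OF Cd[OF z]] zero[OF z] by (simp add: blaschke_prod_on_def)
  next
    case False
    \<comment> \<open>The logarithms of \<open>e j\<close> at \<open>z\<close> and at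
      \<open>z0\<close> may lie on different branches, so only the exponentials of the two sums are
      compared.\<close>
    have "exp (T z - S z) = \<theta>"
      unfolding \<theta>_def using sum_diff[OF z] sum_diff[OF z0(1)]
      by (rule exp_has_sum_cong) (simp add: exp_LM[OF z False] exp_LM[OF z0])
    then have "exp (T z) = \<theta> * exp (S z)" using exp_add[of "T z - S z" "S z"] by simp
    moreover have "blaschke_prod_on J a (C z) = exp (T z)"
      using False zero[OF z] by (simp add: blaschke_prod_on_def T_def L_def)
    moreover have "blaschke_prod_on ?I ?c z = exp (S z)"
      using False by (simp add: blaschke_prod_on_def S_def)
    ultimately show ?thesis using Beq[OF Cd[OF z]] by simp
  qed
  then show ?thesis
    using \<eta> \<theta> by (intro blaschke_productI[OF _ fam, of "\<eta> * \<theta>"]) (auto simp: norm_mult)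
qed

theorem theorem1p1:
  fixes B C :: "complex \<Rightarrow> complex"
  assumes "indestructible_blaschke B" and "indestructible_blaschke C"
  shows "indestructible_blaschke (B \<circ> C)"
proof -
  have "blaschke_product (T \<circ> (B \<circ> C))" if "T \<in> Aut_disk" for T
    using assms that blaschke_product_compose[of "T \<circ> B" C]
    by (simp add: indestructible_blaschke_def comp_assoc)
  then show ?thesis
    using assms blaschke_product_compose[of B C] by (simp add: indestructible_blaschke_def)
qed

end
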